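(* Let $(X,d)$ be a separable ultra-metric space in which all closed balls are compact, let $\mu$ be a Radon measure on $X$ with full support, let $\sigma$ be a distance distribution function, and let $\{P^t\}$ be the isotropic semigroup associated with $(d,\mu,\sigma)$, with Green function $g(x,y)$. The following statements are equivalent (where in (ii) and (iii) either of the options "some" and "all" may be taken). (i) The semigroup $\{P^t\}$ is transient. (ii) $g(x,y)<\infty$ for some/all distinct $x,y\in X$. (iii) For some/all $x\in X$, $$\int^{\infty}\frac{ds}{\mu(B_s^*(x))}<\infty,$$ i.e. the integral converges at $\infty$.
   Context: Closed balls: $B_r(x)=\{y:d(x,y)\le r\}$. A distance distribution function is a strictly increasing left-continuous function $\sigma:[0,\infty]\to[0,1]$ with $\sigma(0+)=0$, $\sigma(\infty)=1$. With $\mathrm{Q}_rf(x)=\frac1{\mu(B_r(x))}\int_{B_r(x)}f\,d\mu$, the isotropic Markov operator associated with $(d,\mu,\sigma)$ is $P=\int_{[0,\infty)}\mathrm{Q}_r\,d\sigma(r)$; the isotropic semigroup is $\{P^t\}_{t\ge0}$, and its heat kernel with respect to $\mu$ is $p(t,x,y)=\int_{[d(x,y),\infty)}\frac{d\sigma^t(r)}{\mu(B_r(x))}$, where $\sigma^t(r)=(\sigma(r))^t$. Green operator (on non-negative Borel functions): $Gf(x)=\int_0^\infty P^tf(x)\,dt=\int_Xg(x,y)f(y)\,d\mu(y)$, where the Green function is $g(x,y)=\int_0^\infty p(t,x,y)\,dt\in[0,\infty]$. The semigroup is called transient if $Gf$ is a bounded function whenever $f$ (non-negative Borel) is bounded and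 has compact support. Intrinsic ultra-metric: $\frac1{d_*(x,y)}=\log\frac1{\sigma(d(x,y))}$ (with $d_*(x,x)=0$); $B^*_s(x)=\{y:d_*(x,y)\le s\}$.
   Formalization: The option "all distinct x,y" in (ii) is claimed only when X has at least two points; for a one-point X it holds vacuously although the semigroup is not transient. *)

theory Defs
  imports "HOL-Analysis.Analysis"
begin

definition ultrametric_space :: "'a::metric_space itself \<Rightarrow> bool" where
  "ultrametric_space _ \<longleftrightarrow> (\<forall>x y z :: 'a. dist x z \<le> max (dist x y) (dist y z))"

definition radon_measure :: "'a::topological_space measure \<Rightarrow> bool" where
  "radon_measure \<mu> \<longleftrightarrow>
     sets \<mu> = sets borel \<and>
     (\<forall>K. compact K \<longrightarrow> emeasure \<mu> K < \<infinity>) \<and>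
     (\<forall>A\<in>sets borel. emeasure \<mu> A = (SUP K\<in>{K. compact K \<and> K \<subseteq> A}. emeasure \<mu> K))"

definition full_support :: "'a::topological_space measure \<Rightarrow> bool" where
  "full_support \<mu> \<longleftrightarrow> (\<forall>U. open U \<and> U \<noteq> {} \<longrightarrow> emeasure \<mu> U > 0)"

text \<open>The domain \<open>[0, \<infinity>]\<close> is the type \<^typ>\<open>ennreal\<close>. Left-continuity is required
  at \<open>\<infinity>\<close> as well, so that \<open>d\<sigma>\<close> has total mass 1 on \<open>[0, \<infinity>)\<close>.\<close>

definition distance_distribution :: "(ennreal \<Rightarrow> real) \<Rightarrow> bool" where
  "distance_distribution \<sigma> \<longleftrightarrow>
     range \<sigma> \<subseteq> {0..1} \<and> strict_mono \<sigma> \<and>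
     (\<forall>r. continuous (at_left r) \<sigma>) \<and>
     (\<sigma> \<longlongrightarrow> 0) (at_right 0) \<and> \<sigma> \<infinity> = 1"

text \<open>The Stieltjes measure of a left-continuous function \<open>F\<close>, giving \<open>[a, b)\<close> the mass
  \<open>F b - F a\<close>. The library's \<^const>\<open>interval_measure\<close> is for right-continuous functions,
  hence the reflection.\<close>

definition left_interval_measure :: "(real \<Rightarrow> real) \<Rightarrow> real measure" where
  "left_interval_measure F = distr (interval_measure (\<lambda>x. - F (- x))) borel uminus"

text \<open>The measure \<open>d\<sigma>\<^sup>t\<close> for \<open>t > 0\<close>; it lives on \<open>[0, \<infinity>)\<close>, since
  \<^const>\<open>ennreal\<close> maps negative reals to 0 and \<open>\<sigma> 0 = 0\<close>.\<close>

definition dsigma :: "(ennreal \<Rightarrow> real) \<Rightarrow> real \<Rightarrow> real measure" where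
  "dsigma \<sigma> t = left_interval_measure (\<lambda>r. \<sigma> (ennreal r) powr t)"

text \<open>All operators act on non-negative Borel functions. The value at \<open>r = 0\<close>, which is
  \<open>0 / 0 = 0\<close> if \<open>{x}\<close> is a null set, is irrelevant because \<open>d\<sigma>\<^sup>t\<close> has no atom at 0.\<close>

definition averaging_op :: "'a::metric_space measure \<Rightarrow> real \<Rightarrow> ('a \<Rightarrow> ennreal) \<Rightarrow> 'a \<Rightarrow> ennreal" where
  "averaging_op \<mu> r f x = (\<integral>\<^sup>+ y \<in> cball x r. f y \<partial>\<mu>) / emeasure \<mu> (cball x r)"

text \<open>The powers of \<open>P = \<integral> Q\<^sub>r d\<sigma>(r)\<close> are \<open>P\<^sup>t = \<integral> Q\<^sub>r d\<sigma>\<^sup>t(r)\<close>, as the averaging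
  operators \<open>Q\<^sub>r\<close> form a decreasing family of commuting projections; see
  \<open>isotropic_semigroup_1\<close> and \<open>isotropic_semigroup_add\<close> below.\<close>

definition isotropic_markov_op ::
  "'a::metric_space measure \<Rightarrow> (ennreal \<Rightarrow> real) \<Rightarrow> ('a \<Rightarrow> ennreal) \<Rightarrow> 'a \<Rightarrow> ennreal" where
  "isotropic_markov_op \<mu> \<sigma> f x =
     (\<integral>\<^sup>+ r \<in> {0..}. averaging_op \<mu> r f x \<partial>left_interval_measure (\<lambda>r. \<sigma> (ennreal r)))"

definition isotropic_semigroup ::
  "'a::metric_space measure \<Rightarrow> (ennreal \<Rightarrow> real) \<Rightarrow> real \<Rightarrow> ('a \<Rightarrow> ennreal) \<Rightarrow> 'a \<Rightarrow> ennreal" where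
  "isotropic_semigroup \<mu> \<sigma> t f x =
     (if t = 0 then f x else \<integral>\<^sup>+ r \<in> {0..}. averaging_op \<mu> r f x \<partial>dsigma \<sigma> t)"

definition heat_kernel ::
  "'a::metric_space measure \<Rightarrow> (ennreal \<Rightarrow> real) \<Rightarrow> real \<Rightarrow> 'a \<Rightarrow> 'a \<Rightarrow> ennreal" where
  "heat_kernel \<mu> \<sigma> t x y = (\<integral>\<^sup>+ r \<in> {dist x y..}. 1 / emeasure \<mu> (cball x r) \<partial>dsigma \<sigma> t)"

definition green_function ::
  "'a::metric_space measure \<Rightarrow> (ennreal \<Rightarrow> real) \<Rightarrow> 'a \<Rightarrow> 'a \<Rightarrow> ennreal" where
  "green_function \<mu> \<sigma> x y = (\<integral>\<^sup>+ t \<in> {0..}. heat_kernel \<mu> \<sigma> t x y \<partial>lborel)"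

definition green_operator ::
  "'a::metric_space measure \<Rightarrow> (ennreal \<Rightarrow> real) \<Rightarrow> ('a \<Rightarrow> ennreal) \<Rightarrow> 'a \<Rightarrow> ennreal" where
  "green_operator \<mu> \<sigma> f x = (\<integral>\<^sup>+ t \<in> {0..}. isotropic_semigroup \<mu> \<sigma> t f x \<partial>lborel)"

definition bounded_ennreal :: "('a \<Rightarrow> ennreal) \<Rightarrow> bool" where
  "bounded_ennreal f \<longleftrightarrow> (\<exists>C::real. \<forall>x. f x \<le> ennreal C)"

definition transient_semigroup :: "'a::metric_space measure \<Rightarrow> (ennreal \<Rightarrow> real) \<Rightarrow> bool" where
  "transient_semigroup \<mu> \<sigma> \<longleftrightarrow>
     (\<forall>f \<in> borel_measurable borel. bounded_ennreal f \<and> compact (closure {x. f x \<noteq> 0}) \<longrightarrow>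
        bounded_ennreal (green_operator \<mu> \<sigma> f))"

definition intrinsic_dist :: "(ennreal \<Rightarrow> real) \<Rightarrow> 'a::metric_space \<Rightarrow> 'a \<Rightarrow> real" where
  "intrinsic_dist \<sigma> x y = (if x = y then 0 else 1 / ln (1 / \<sigma> (ennreal (dist x y))))"

definition intrinsic_cball :: "(ennreal \<Rightarrow> real) \<Rightarrow> 'a::metric_space \<Rightarrow> real \<Rightarrow> 'a set" where
  "intrinsic_cball \<sigma> x s = {y. intrinsic_dist \<sigma> x y \<le> s}"

definition converges_at_infinity :: "(real \<Rightarrow> ennreal) \<Rightarrow> bool" where
  "converges_at_infinity h \<longleftrightarrow> (\<exists>a. (\<integral>\<^sup>+ s \<in> {a..}. h s \<partial>lborel) < \<infinity>)"

subsection \<open>The semigroup law\<close>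

lemma emeasure_left_interval_measure:
  assumes F: "mono F" "\<And>x. continuous (at_left x) F" and ab: "a \<le> b"
  shows "emeasure (left_interval_measure F) {a..<b} = ennreal (F b - F a)"
proof -
  have vim: "uminus -` {a..<b} = {-b<..-a}"
    by auto
  have cont: "continuous (at_right x) (\<lambda>x. - F (- x))" for x
  proof -
    have "filterlim uminus (at_left (- x)) (at_right x)"
      by (simp add: filterlim_def at_left_minus filtermap_filtermap)
    moreover have "(F \<longlongrightarrow> F (- x)) (at_left (- x))"
      using F(2)[of "- x"] by (simp add: continuous_within)
    ultimately have "((\<lambda>x. F (- x)) \<longlongrightarrow> F (- x)) (at_right x)"
      by (rule filterlim_compose[rotated])
    then show ?thesis
      by (auto simp: continuous_within intro: tendsto_minus)
  qed
  have "emeasure (left_interval_measure F) {a..<b} =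
      emeasure (interval_measure (\<lambda>x. - F (- x))) {-b<..-a}"
    unfolding left_interval_measure_def by (subst emeasure_distr) (simp_all add: vim)
  also have "\<dots> = ennreal (- F (- (- a)) - - F (- (- b)))"
    using ab cont monoD[OF F(1)] by (subst emeasure_interval_measure_Ioc) auto
  finally show ?thesis by simp
qed


lemma sets_left_interval_measure [simp, measurable_cong]:
  "sets (left_interval_measure F) = sets borel"
  by (simp add: left_interval_measure_def)

lemma space_left_interval_measure [simp]: "space (left_interval_measure F) = UNIV"
  by (simp add: left_interval_measure_def)

lemma emeasure_left_interval_measure_lessThan:
  assumes F: "mono F" "\<And>x. continuous (at_left x) F" and 0: "\<And>x. x \<le> 0 \<Longrightarrow> F x = 0"
  shows "emeasure (left_interval_measure F) {..<w} = ennreal (F w)"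
proof -
  let ?M = "left_interval_measure F"
  have Un: "{..<0::real} = (\<Union>n::nat. {- real n..<0})"
    by (auto simp: neg_le_iff_le) (metis minus_le_iff real_arch_simple)
  have null: "{..<0} \<in> null_sets ?M"
    unfolding Un
    by (intro null_sets_UN) (auto simp: null_sets_def emeasure_left_interval_measure[OF F] 0)
  show ?thesis
  proof (cases "w \<le> 0")
    case True
    then have "{..<w} \<in> null_sets ?M"
      by (intro null_sets_subset[OF null]) auto
    with True show ?thesis by (simp add: null_setsD1 0)
  next
    case False
    then have "{..<w} = {..<0} \<union> {0..<w}" by auto
    also have "emeasure ?M \<dots> = emeasure ?M {0..<w}"
      by (subst Un_commute, intro emeasure_Un_null_set null) auto
    also have "\<dots> = ennreal (F w)"
      using False by (subst emeasure_left_interval_measure[OF F]) (auto simp: 0)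
    finally show ?thesis .
  qed
qed

lemma
  assumes \<sigma>: "distance_distribution \<sigma>"
  shows distance_distribution_0: "\<sigma> 0 = 0"
    and distance_distribution_nonneg: "0 \<le> \<sigma> r"
    and distance_distribution_powr_mono: "t > 0 \<Longrightarrow> mono (\<lambda>r. \<sigma> (ennreal r) powr t)"
    and distance_distribution_powr_continuous:
      "t > 0 \<Longrightarrow> continuous (at_left u) (\<lambda>r. \<sigma> (ennreal r) powr t)"
proof -
  show nonneg: "0 \<le> \<sigma> r" for r
    using \<sigma> unfolding distance_distribution_def by (meson atLeastAtMost_iff rangeI subsetD)
  have mono: "mono \<sigma>"
    using \<sigma> by (auto simp: distance_distribution_def strict_mono_mono)
  have lim: "(\<sigma> \<longlongrightarrow> 0) (at_right 0)"
    using \<sigma> by (auto simp: distance_distribution_def)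
  have "\<sigma> 0 \<le> 0"
  proof (rule tendsto_lowerbound[OF lim])
    show "\<forall>\<^sub>F x in at_right 0. \<sigma> 0 \<le> \<sigma> x"
      using monoD[OF mono] by (auto intro!: always_eventually)
    show "at_right (0::ennreal) \<noteq> bot"
      using dense[of "0::ennreal"] eventually_at_right[of "0::ennreal" 1 "\<lambda>_. False"]
      by (auto simp: trivial_limit_def)
         (metis dense ennreal_zero_less_one not_gr_zero)
  qed
  with nonneg show \<sigma>0: "\<sigma> 0 = 0" by (simp add: antisym)
  show "mono (\<lambda>r. \<sigma> (ennreal r) powr t)" if "t > 0"
    using that nonneg by (intro monoI powr_mono2 monoD[OF mono] ennreal_leI) auto
  show "continuous (at_left u) (\<lambda>r. \<sigma> (ennreal r) powr t)" if t: "t > 0"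
  proof (cases "u \<le> 0")
    case True
    have ev: "\<forall>\<^sub>F r in at_left u. 0 = \<sigma> (ennreal r) powr t"
      unfolding eventually_at_filter using True
      by (intro always_eventually) (auto simp: ennreal_neg \<sigma>0)
    have "((\<lambda>r. \<sigma> (ennreal r) powr t) \<longlongrightarrow> 0) (at_left u)"
      by (rule Lim_transform_eventually[OF tendsto_const ev])
    with True show ?thesis by (simp add: continuous_within ennreal_neg \<sigma>0)
  next
    case False
    have lt: "ennreal x < ennreal u" if "x < u" for x
      using False that by (intro ennreal_lessI) auto
    have "filterlim ennreal (at_left (ennreal u)) (at_left u)"
      unfolding filterlim_at eventually_at_filter
      by (auto intro!: tendsto_intros always_eventually dest!: lt)
    moreover have "(\<sigma> \<longlongrightarrow> \<sigma> (ennreal u)) (at_left (ennreal u))"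
      using \<sigma> by (auto simp: distance_distribution_def continuous_within)
    ultimately have "((\<lambda>r. \<sigma> (ennreal r)) \<longlongrightarrow> \<sigma> (ennreal u)) (at_left u)"
      by (rule filterlim_compose[rotated])
    then show ?thesis
      unfolding continuous_within using t nonneg
      by (intro tendsto_powr') auto
  qed
qed

lemma emeasure_dsigma_lessThan:
  assumes "distance_distribution \<sigma>" "t > 0"
  shows "emeasure (dsigma \<sigma> t) {..<w} = ennreal (\<sigma> (ennreal w) powr t)"
  unfolding dsigma_def using assms
  by (intro emeasure_left_interval_measure_lessThan)
     (auto simp: distance_distribution_powr_mono distance_distribution_powr_continuous
        ennreal_neg distance_distribution_0)

lemma sets_dsigma [simp, measurable_cong]: "sets (dsigma \<sigma> t) = sets borel"
  and space_dsigma [simp]: "space (dsigma \<sigma> t) = UNIV"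
  by (simp_all add: dsigma_def)

lemma borel_eq_lessThan_generator: "sets (borel :: real measure) = sigma_sets UNIV (range lessThan)"
  by (subst borel_eq_lessThan) (simp add: lessThan_def eucl_less_def)

lemma measure_eqI_lessThan_real:
  fixes M N :: "real measure"
  assumes "sets M = sets borel" "sets N = sets borel"
    and "\<And>x. emeasure M {..<x} = emeasure N {..<x}" "\<And>x. emeasure M {..<x} < \<infinity>"
  shows "M = N"
proof (rule measure_eqI_generator_eq[where A = "\<lambda>n::nat. {..<real n}" and \<Omega> = UNIV])
  show "Int_stable (range lessThan :: real set set)"
  proof (clarsimp simp: Int_stable_def)
    show "{..<a} \<inter> {..<b} \<in> range lessThan" for a b :: real
      by (rule image_eqI[of _ _ "min a b"]) auto
  qed
  show "(\<Union>n::nat. {..<real n}) = UNIV"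
    using reals_Archimedean2 by auto
qed (use assms in \<open>auto simp: borel_eq_lessThan_generator less_top\<close>)

lemma sigma_finite_dsigma:
  assumes "distance_distribution \<sigma>" "t > 0"
  shows "sigma_finite_measure (dsigma \<sigma> t)"
proof
  show "\<exists>A. countable A \<and> A \<subseteq> sets (dsigma \<sigma> t) \<and> \<Union>A = space (dsigma \<sigma> t) \<and>
      (\<forall>a\<in>A. emeasure (dsigma \<sigma> t) a \<noteq> \<infinity>)"
    by (rule exI[of _ "range (\<lambda>n::nat. {..<real n})"])
       (use reals_Archimedean2 in \<open>auto simp: emeasure_dsigma_lessThan[OF assms]\<close>)
qed

lemma AE_dsigma_pos:
  assumes "distance_distribution \<sigma>" "t > 0"
  shows "AE r in dsigma \<sigma> t. r > 0"
proof (rule AE_I)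
  show "{r \<in> space (dsigma \<sigma> t). \<not> r > 0} \<subseteq> {..0}" by auto
  have lim: "((\<lambda>n. \<sigma> (ennreal (1 / real (Suc n))) powr t) \<longlongrightarrow> 0) sequentially"
  proof -
    have "((\<lambda>n. ennreal (1 / real (Suc n))) \<longlongrightarrow> ennreal 0) sequentially"
      by (intro tendsto_ennrealI LIMSEQ_Suc[OF lim_1_over_n])
    then have "filterlim (\<lambda>n. ennreal (1 / real (Suc n))) (at_right 0) sequentially"
      unfolding filterlim_at by (auto intro!: always_eventually simp del: of_nat_Suc)
    then have "((\<lambda>n. \<sigma> (ennreal (1 / real (Suc n)))) \<longlongrightarrow> 0) sequentially"
      using assms by (auto simp: distance_distribution_def intro: filterlim_compose)
    from tendsto_powr'[OF this tendsto_const[of t]] assms show ?thesis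
      by (auto simp: distance_distribution_nonneg)
  qed
  have le: "emeasure (dsigma \<sigma> t) {..0} \<le> ennreal (\<sigma> (ennreal (1 / real (Suc n))) powr t)" for n
    by (subst emeasure_dsigma_lessThan[OF assms, symmetric], intro emeasure_mono)
       (auto intro: order_le_less_trans)
  have "emeasure (dsigma \<sigma> t) {..0} \<le> ennreal 0"
    using le by (intro LIMSEQ_le_const[OF tendsto_ennrealI[OF lim]]) blast
  then show "emeasure (dsigma \<sigma> t) {..0} = 0" by simp
qed simp

lemma dsigma_max:
  assumes \<sigma>: "distance_distribution \<sigma>" and s: "s > 0" and t: "t > 0"
  shows "distr (dsigma \<sigma> s \<Otimes>\<^sub>M dsigma \<sigma> t) borel (\<lambda>(r, u). max r u) = dsigma \<sigma> (s + t)"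
proof (rule measure_eqI_lessThan_real)
  interpret t: sigma_finite_measure "dsigma \<sigma> t"
    using sigma_finite_dsigma[OF \<sigma> t] .
  have meas: "(\<lambda>(r, u). max r u) \<in> dsigma \<sigma> s \<Otimes>\<^sub>M dsigma \<sigma> t \<rightarrow>\<^sub>M (borel :: real measure)"
    by measurable
  have vim: "(\<lambda>(r, u). max r u) -` {..<w} \<inter> space (dsigma \<sigma> s \<Otimes>\<^sub>M dsigma \<sigma> t) = {..<w} \<times> {..<w}"
    for w :: real
    by (auto simp: space_pair_measure)
  show "emeasure (distr (dsigma \<sigma> s \<Otimes>\<^sub>M dsigma \<sigma> t) borel (\<lambda>(r, u). max r u)) {..<w} =
      emeasure (dsigma \<sigma> (s + t)) {..<w}" for w
    using s t
    by (subst emeasure_distr[OF meas])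
       (simp_all add: vim t.emeasure_pair_measure_Times emeasure_dsigma_lessThan[OF \<sigma>]
          ennreal_mult[symmetric] powr_add)
  then show "emeasure (distr (dsigma \<sigma> s \<Otimes>\<^sub>M dsigma \<sigma> t) borel (\<lambda>(r, u). max r u)) {..<w} < \<infinity>"
    for w
    using s t by (simp add: emeasure_dsigma_lessThan[OF \<sigma>])
qed simp_all

lemma measurable_dist_separable:
  assumes "separable_space (euclidean :: 'a::metric_space topology)"
  shows "(\<lambda>(y, z :: 'a). dist y z) \<in> borel \<Otimes>\<^sub>M borel \<rightarrow>\<^sub>M borel"
proof -
  from assms obtain D :: "'a set" where D: "countable D" "closure D = UNIV"
    by (auto simp: separable_space_def)
  have "{p \<in> space (borel \<Otimes>\<^sub>M borel). (\<lambda>(y, z :: 'a). dist y z) p < c} =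
      (\<Union>d\<in>D. \<Union>q\<in>\<rat>. ball d q \<times> ball d (c - q))" for c
  proof (intro set_eqI iffI)
    fix p assume "p \<in> {p \<in> space (borel \<Otimes>\<^sub>M borel). (\<lambda>(y, z :: 'a). dist y z) p < c}"
    then obtain y z where p: "p = (y, z)" and yz: "dist y z < c" by (cases p) auto
    define e where "e = (c - dist y z) / 2"
    have "y \<in> closure D" "e > 0" using D yz by (auto simp: e_def)
    then obtain d where d: "d \<in> D" "dist d y < e"
      unfolding closure_approachable by blast
    then have "dist d y < c - dist d z"
      using dist_triangle[of d z y] by (auto simp: e_def field_simps)
    then obtain q where "q \<in> \<rat>" "dist d y < q" "q < c - dist d z"
      using Rats_dense_in_real by blast
    then show "p \<in> (\<Union>d\<in>D. \<Union>q\<in>\<rat>. ball d q \<times> ball d (c - q))"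
      using p d by (auto intro!: bexI[of _ d] bexI[of _ q])
  next
    fix p assume "p \<in> (\<Union>d\<in>D. \<Union>q\<in>\<rat>. ball d q \<times> ball d (c - q))"
    then obtain y z d q where "p = (y, z)" "dist d y < q" "dist d z < c - q" by auto
    then show "p \<in> {p \<in> space (borel \<Otimes>\<^sub>M borel). (\<lambda>(y, z :: 'a). dist y z) p < c}"
      using dist_triangle3[of y z d] by (auto simp: space_pair_measure)
  qed
  moreover have "(\<Union>d\<in>D. \<Union>q\<in>\<rat>. ball d q \<times> ball d (c - q)) \<in> sets (borel \<Otimes>\<^sub>M (borel :: 'a measure))" for c
    by (intro sets.countable_UN'' D countable_rat) auto
  ultimately show ?thesis
    by (intro borel_measurableI_less) simp
qed

lemma ultrametric_cball_eq:
  assumes "ultrametric_space TYPE('a::metric_space)" "dist x y \<le> r"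
  shows "cball (x::'a) r = cball y r"
proof -
  have "dist a c \<le> r" if "dist a b \<le> r" "dist b c \<le> r" for a b c :: 'a
    using that assms(1) by (meson max.boundedI order_trans ultrametric_space_def)
  then show ?thesis using assms(2) by (auto simp: dist_commute)
qed

theorem isotropic_semigroup_1:
  assumes "distance_distribution \<sigma>"
  shows "isotropic_semigroup \<mu> \<sigma> 1 = isotropic_markov_op \<mu> \<sigma>"
  using assms
  by (intro ext) (simp add: isotropic_semigroup_def isotropic_markov_op_def dsigma_def
      powr_one_gt_zero_iff distance_distribution_nonneg)

lemma radon_sigma_finite:
  fixes \<mu> :: "'a::metric_space measure"
  assumes "\<forall>(x::'a) r. compact (cball x r)" "radon_measure \<mu>"
  shows "sigma_finite_measure \<mu>"
proof
  have "(\<Union>n::nat. cball (undefined :: 'a) (real n)) = UNIV"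
    using real_arch_simple by auto
  moreover have "space \<mu> = UNIV" "sets \<mu> = sets borel"
    using assms(2) sets_eq_imp_space_eq[of \<mu> borel] by (auto simp: radon_measure_def)
  moreover have "emeasure \<mu> (cball x r) \<noteq> \<infinity>" for x r
    using assms unfolding radon_measure_def by (metis order_less_irrefl)
  ultimately show "\<exists>A. countable A \<and> A \<subseteq> sets \<mu> \<and> \<Union>A = space \<mu> \<and> (\<forall>a\<in>A. emeasure \<mu> a \<noteq> \<infinity>)"
    by (intro exI[of _ "range (\<lambda>n::nat. cball undefined (real n))"]) auto
qed

lemma measurable_averaging_op:
  fixes \<mu> :: "'a::metric_space measure"
  assumes sep: "separable_space (euclidean :: 'a topology)"
    and \<mu>: "sigma_finite_measure \<mu>" "sets \<mu> = sets borel"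
    and f: "f \<in> borel_measurable borel"
  shows "(\<lambda>(r, x). averaging_op \<mu> r f x) \<in> borel_measurable (borel \<Otimes>\<^sub>M borel)"
proof -
  interpret sigma_finite_measure \<mu> by fact
  note [measurable_cong] = \<mu>(2)
  note [measurable] = f measurable_dist_separable[OF sep]
  have eq: "averaging_op \<mu> r f x =
      (\<integral>\<^sup>+ y. f y * of_bool (dist x y \<le> r) \<partial>\<mu>) / (\<integral>\<^sup>+ y. of_bool (dist x y \<le> r) \<partial>\<mu>)" for r x
  proof -
    have "emeasure \<mu> (cball x r) = (\<integral>\<^sup>+ y. indicator (cball x r) y \<partial>\<mu>)"
      using \<mu> by (subst nn_integral_indicator) auto
    then show ?thesis
      by (simp add: averaging_op_def indicator_def of_bool_def)
  qed
  show ?thesis unfolding eq by measurable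
qed

lemma averaging_op_comp:
  fixes \<mu> :: "'a::metric_space measure"
  assumes sep: "separable_space (euclidean :: 'a topology)" and um: "ultrametric_space TYPE('a)"
    and balls: "\<forall>(x::'a) r. compact (cball x r)"
    and \<mu>: "radon_measure \<mu>" "full_support \<mu>"
    and f: "f \<in> borel_measurable borel" and r: "r > 0" and u: "u > 0"
  shows "averaging_op \<mu> r (averaging_op \<mu> u f) x = averaging_op \<mu> (max r u) f x"
proof -
  interpret sigma_finite_measure \<mu> by (rule radon_sigma_finite) fact+
  interpret P: pair_sigma_finite \<mu> \<mu> ..
  have sets: "sets \<mu> = sets borel" using \<mu>(1) by (simp add: radon_measure_def)
  have fin: "emeasure \<mu> (cball y v) < top" for y v
    using balls \<mu>(1) unfolding radon_measure_def by (metis infinity_ennreal_def)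
  have pos: "emeasure \<mu> (cball y v) > 0" if "v > 0" for y v
  proof -
    have "0 < emeasure \<mu> (ball y v)" using that \<mu>(2) by (auto simp: full_support_def)
    also have "\<dots> \<le> emeasure \<mu> (cball y v)" by (intro emeasure_mono) (auto simp: sets)
    finally show ?thesis .
  qed
  note [measurable_cong] = sets
  note [measurable] = f measurable_dist_separable[OF sep]
  show ?thesis
  proof (cases "r \<le> u")
    case True
    have "averaging_op \<mu> u f y = averaging_op \<mu> u f x" if "y \<in> cball x r" for y
      using ultrametric_cball_eq[OF um, of x y u] that True by (simp add: averaging_op_def)
    then have "(\<integral>\<^sup>+ y\<in>cball x r. averaging_op \<mu> u f y \<partial>\<mu>) =
        (\<integral>\<^sup>+ y\<in>cball x r. averaging_op \<mu> u f x \<partial>\<mu>)"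
      by (intro nn_integral_cong) (auto simp: indicator_def)
    also have "\<dots> = averaging_op \<mu> u f x * emeasure \<mu> (cball x r)"
      by (subst nn_integral_cmult_indicator) (auto simp: sets)
    finally show ?thesis
      using True fin[of x r] pos[OF r, of x]
      by (simp add: averaging_op_def[of \<mu> r] max_def ennreal_mult_divide_eq
          mult_divide_eq_ennreal less_top)
  next
    case False
    let ?m = "\<lambda>y. emeasure \<mu> (cball y u)"
    have m: "?m y = (\<integral>\<^sup>+ z. of_bool (dist y z \<le> u) \<partial>\<mu>)" for y
    proof -
      have "?m y = (\<integral>\<^sup>+ z. indicator (cball y u) z \<partial>\<mu>)"
        by (subst nn_integral_indicator) (auto simp: sets)
      then show ?thesis by (simp add: indicator_def of_bool_def)
    qed
    have [measurable]: "?m \<in> borel_measurable borel" unfolding m by measurable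
    have swap: "dist x y \<le> r \<and> dist y z \<le> u \<longleftrightarrow> dist x z \<le> r \<and> dist z y \<le> u" for y z
      using um False unfolding ultrametric_space_def
      by (smt (verit) dist_commute)
    have "(\<integral>\<^sup>+ y\<in>cball x r. averaging_op \<mu> u f y \<partial>\<mu>) =
        (\<integral>\<^sup>+ y. (\<integral>\<^sup>+ z. of_bool (dist x y \<le> r) * (f z * of_bool (dist y z \<le> u) / ?m y) \<partial>\<mu>) \<partial>\<mu>)"
    proof (intro nn_integral_cong)
      fix y
      have "averaging_op \<mu> u f y * indicator (cball x r) y =
          of_bool (dist x y \<le> r) * ((\<integral>\<^sup>+ z. f z * of_bool (dist y z \<le> u) \<partial>\<mu>) / ?m y)"
        by (auto simp: averaging_op_def indicator_def of_bool_def)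
      also have "\<dots> = of_bool (dist x y \<le> r) * (\<integral>\<^sup>+ z. f z * of_bool (dist y z \<le> u) / ?m y \<partial>\<mu>)"
        by (subst nn_integral_divide) auto
      also have "\<dots> = (\<integral>\<^sup>+ z. of_bool (dist x y \<le> r) * (f z * of_bool (dist y z \<le> u) / ?m y) \<partial>\<mu>)"
        by (subst nn_integral_cmult) auto
      finally show "averaging_op \<mu> u f y * indicator (cball x r) y = \<dots>" .
    qed
    also have "\<dots> =
        (\<integral>\<^sup>+ z. (\<integral>\<^sup>+ y. of_bool (dist x y \<le> r) * (f z * of_bool (dist y z \<le> u) / ?m y) \<partial>\<mu>) \<partial>\<mu>)"
      by (subst P.Fubini') auto
    also have "\<dots> = (\<integral>\<^sup>+ z. (\<integral>\<^sup>+ y. (of_bool (dist x z \<le> r) * f z / ?m z) * of_bool (dist z y \<le> u) \<partial>\<mu>) \<partial>\<mu>)"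
    proof (intro nn_integral_cong)
      fix z y
      show "of_bool (dist x y \<le> r) * (f z * of_bool (dist y z \<le> u) / ?m y) =
          (of_bool (dist x z \<le> r) * f z / ?m z) * of_bool (dist z y \<le> u)"
        using swap[of y z] ultrametric_cball_eq[OF um, of z y u]
        by (cases "dist z y \<le> u") (auto simp: of_bool_def dist_commute)
    qed
    also have "\<dots> = (\<integral>\<^sup>+ z. (of_bool (dist x z \<le> r) * f z / ?m z) * ?m z \<partial>\<mu>)"
      by (subst nn_integral_cmult) (auto simp: m)
    also have "\<dots> = (\<integral>\<^sup>+ z\<in>cball x r. f z \<partial>\<mu>)"
    proof (intro nn_integral_cong)
      fix z
      have "f z / ?m z * ?m z = f z"
        using fin[of z u] pos[OF u, of z]
        by (simp add: ennreal_divide_times ennreal_mult_divide_eq mult_divide_eq_ennreal less_top)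
      then show "(of_bool (dist x z \<le> r) * f z / ?m z) * ?m z = f z * indicator (cball x r) z"
        by (auto simp: indicator_def of_bool_def)
    qed
    finally show ?thesis
      using False by (simp add: averaging_op_def[of \<mu> r] max_def)
  qed
qed

theorem isotropic_semigroup_add:
  fixes \<mu> :: "'a::metric_space measure"
  assumes sep: "separable_space (euclidean :: 'a topology)" and um: "ultrametric_space TYPE('a)"
    and balls: "\<forall>(x::'a) r. compact (cball x r)"
    and \<mu>: "radon_measure \<mu>" "full_support \<mu>" and \<sigma>: "distance_distribution \<sigma>"
    and f: "f \<in> borel_measurable borel" and st: "s \<ge> 0" "t \<ge> 0"
  shows "isotropic_semigroup \<mu> \<sigma> s (isotropic_semigroup \<mu> \<sigma> t f) =
    isotropic_semigroup \<mu> \<sigma> (s + t) f"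
proof (cases "s = 0 \<or> t = 0")
  case True
  then show ?thesis by (auto simp: isotropic_semigroup_def fun_eq_iff averaging_op_def)
next
  case False
  with st have s: "s > 0" and t: "t > 0" by auto
  let ?S = "dsigma \<sigma> s" and ?T = "dsigma \<sigma> t" and ?Q = "averaging_op \<mu>"
  have P: "isotropic_semigroup \<mu> \<sigma> v h y = (\<integral>\<^sup>+ r. ?Q r h y \<partial>dsigma \<sigma> v)" if "v > 0" for v h y
  proof -
    have "AE r in dsigma \<sigma> v. ?Q r h y * indicator {0..} r = ?Q r h y"
      using AE_dsigma_pos[OF \<sigma> that] by eventually_elim (simp add: indicator_def)
    then show ?thesis
      using that by (simp add: isotropic_semigroup_def) (rule nn_integral_cong_AE)
  qed
  interpret M: sigma_finite_measure \<mu> by (rule radon_sigma_finite) fact+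
  interpret S: sigma_finite_measure ?S by (rule sigma_finite_dsigma) fact+
  interpret T: sigma_finite_measure ?T by (rule sigma_finite_dsigma) fact+
  interpret MT: pair_sigma_finite \<mu> ?T ..
  have sets: "sets \<mu> = sets borel" using \<mu>(1) by (simp add: radon_measure_def)
  note [measurable_cong] = sets
  note [measurable] = measurable_averaging_op[OF sep M.sigma_finite_measure_axioms sets f]
  have [measurable]: "(\<lambda>(y, u). ?Q u f y) \<in> borel_measurable (borel \<Otimes>\<^sub>M borel)"
    using measurable_compose[OF measurable_pair_swap'
        measurable_averaging_op[OF sep M.sigma_finite_measure_axioms sets f]]
    by (simp add: case_prod_beta')
  have [measurable]: "cball y r \<in> sets borel" for y :: 'a and r by simp
  show ?thesis
  proof
    fix x
    have "isotropic_semigroup \<mu> \<sigma> s (isotropic_semigroup \<mu> \<sigma> t f) x =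
        (\<integral>\<^sup>+ r. ?Q r (\<lambda>y. \<integral>\<^sup>+ u. ?Q u f y \<partial>?T) x \<partial>?S)"
      using ext[of "isotropic_semigroup \<mu> \<sigma> t f", OF P[OF t]] by (simp add: P[OF s])
    also have "\<dots> = (\<integral>\<^sup>+ r. (\<integral>\<^sup>+ u. ?Q r (?Q u f) x \<partial>?T) \<partial>?S)"
    proof (intro nn_integral_cong)
      fix r
      have "(\<integral>\<^sup>+ y\<in>cball x r. (\<integral>\<^sup>+ u. ?Q u f y \<partial>?T) \<partial>\<mu>) =
          (\<integral>\<^sup>+ y. (\<integral>\<^sup>+ u. ?Q u f y * indicator (cball x r) y \<partial>?T) \<partial>\<mu>)"
        by (intro nn_integral_cong nn_integral_multc[symmetric]) auto
      also have "\<dots> = (\<integral>\<^sup>+ u. (\<integral>\<^sup>+ y\<in>cball x r. ?Q u f y \<partial>\<mu>) \<partial>?T)"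
        by (subst MT.Fubini') auto
      finally show "?Q r (\<lambda>y. \<integral>\<^sup>+ u. ?Q u f y \<partial>?T) x = (\<integral>\<^sup>+ u. ?Q r (?Q u f) x \<partial>?T)"
        unfolding averaging_op_def[of \<mu> r]
        by (subst nn_integral_divide) auto
    qed
    also have "\<dots> = (\<integral>\<^sup>+ r. (\<integral>\<^sup>+ u. ?Q (max r u) f x \<partial>?T) \<partial>?S)"
    proof (rule nn_integral_cong_AE)
      show "AE r in ?S. (\<integral>\<^sup>+ u. ?Q r (?Q u f) x \<partial>?T) = (\<integral>\<^sup>+ u. ?Q (max r u) f x \<partial>?T)"
        using AE_dsigma_pos[OF \<sigma> s]
      proof eventually_elim
        fix r :: real assume r: "r > 0"
        show "(\<integral>\<^sup>+ u. ?Q r (?Q u f) x \<partial>?T) = (\<integral>\<^sup>+ u. ?Q (max r u) f x \<partial>?T)"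
        proof (rule nn_integral_cong_AE)
          show "AE u in ?T. ?Q r (?Q u f) x = ?Q (max r u) f x"
            using AE_dsigma_pos[OF \<sigma> t]
            by eventually_elim (rule averaging_op_comp[OF sep um balls \<mu> f r])
        qed
      qed
    qed
    also have "\<dots> = (\<integral>\<^sup>+ p. ?Q (case p of (r, u) \<Rightarrow> max r u) f x \<partial>(?S \<Otimes>\<^sub>M ?T))"
      by (subst T.nn_integral_fst[symmetric]) auto
    also have "\<dots> = (\<integral>\<^sup>+ w. ?Q w f x \<partial>distr (?S \<Otimes>\<^sub>M ?T) borel (\<lambda>(r, u). max r u))"
      by (subst nn_integral_distr) auto
    also have "\<dots> = isotropic_semigroup \<mu> \<sigma> (s + t) f x"
      using s t by (simp add: dsigma_max[OF \<sigma>] P)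
    finally show "isotropic_semigroup \<mu> \<sigma> s (isotropic_semigroup \<mu> \<sigma> t f) x =
        isotropic_semigroup \<mu> \<sigma> (s + t) f x" .
  qed
qed

end

theory Submission
  imports Defs "HOL-Real_Asymp.Real_Asymp"
begin

text \<open>
  Let \<open>R(s) = sup {r. \<sigma>(r) \<le> exp(-1/s)}\<close>, so that \<open>r \<le> R(s)\<close> iff \<open>\<sigma>(r) \<le> exp(-1/s)\<close>. Then the
  intrinsic ball \<open>B\<^sup>*\<^sub>s(x)\<close> is the closed ball of radius \<open>R(s)\<close>, and \<open>d\<sigma>\<^sup>t\<close> is the image under \<open>R\<close> of
  the probability measure on \<open>(0, \<infinity>)\<close> with distribution function \<open>exp(-t/s)\<close> and density
  \<open>t/s\<^sup>2 exp(-t/s)\<close>. For fixed \<open>s\<close> this density has integral 1 over \<open>t \<in> (0, \<infinity>)\<close>, whence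
  \<open>g(x, y)\<close> is the integral of \<open>1/\<mu>(B\<^sup>*\<^sub>s(x))\<close> over \<open>s \<ge> d\<^sub>*(x, y)\<close> and \<open>G f(x)\<close> is the integral
  of \<open>Q\<^bsub>R(s)\<^esub> f(x)\<close> over \<open>s > 0\<close>. By the ultra-metric inequality \<open>B\<^sup>*\<^sub>s(x) = B\<^sup>*\<^sub>s(y)\<close> for
  \<open>s \<ge> d\<^sub>*(x, y)\<close>, so convergence does not depend on \<open>x\<close>.
\<close>

section \<open>The quantile function of \<sigma>\<close>

text \<open>The clause for \<open>s \<le> 0\<close> keeps the function monotone, hence measurable, on the whole line.\<close>

definition sigma_quantile :: "(ennreal \<Rightarrow> real) \<Rightarrow> real \<Rightarrow> real" where
  "sigma_quantile \<sigma> s = (if s \<le> 0 then 0 else Sup {r. \<sigma> (ennreal r) \<le> exp (- (1 / s))})"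

lemma
  assumes \<sigma>: "distance_distribution \<sigma>"
  shows distance_distribution_mono: "a \<le> b \<Longrightarrow> \<sigma> a \<le> \<sigma> b"
    and distance_distribution_pos: "r > 0 \<Longrightarrow> \<sigma> (ennreal r) > 0"
    and distance_distribution_less_1: "\<sigma> (ennreal r) < 1"
proof -
  have sm: "strict_mono \<sigma>" and top: "\<sigma> \<infinity> = 1"
    using \<sigma> by (auto simp: distance_distribution_def)
  show "a \<le> b \<Longrightarrow> \<sigma> a \<le> \<sigma> b" using sm by (simp add: strict_mono_less_eq)
  show "r > 0 \<Longrightarrow> \<sigma> (ennreal r) > 0"
    using strict_monoD[OF sm, of 0 "ennreal r"] distance_distribution_0[OF \<sigma>] by simp
  show "\<sigma> (ennreal r) < 1"
    using strict_monoD[OF sm, of "ennreal r" \<infinity>] top by (simp add: ennreal_less_top)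
qed

text \<open>Left-continuity at infinity, where \<sigma> equals 1, makes \<sigma> exceed
  \<open>c\<close> just below infinity. This keeps the set in \<open>sigma_quantile\<close> bounded
  above, so that its \<open>Sup\<close> is a true supremum.\<close>

lemma distance_distribution_exceeds:
  assumes \<sigma>: "distance_distribution \<sigma>" and c: "c < 1"
  obtains r where "\<sigma> (ennreal r) > c"
proof -
  have "(\<sigma> \<longlongrightarrow> 1) (at_left top)"
    using \<sigma> unfolding distance_distribution_def by (metis continuous_within infinity_ennreal_def)
  then have "\<forall>\<^sub>F x in at_left top. \<sigma> x > c"
    using c by (rule order_tendstoD)
  then obtain b where b: "b < top" "\<And>y. b < y \<Longrightarrow> y < top \<Longrightarrow> \<sigma> y > c"
    using eventually_at_left[of "0::ennreal" top] by auto
  obtain y where "b < y" "y < top" using dense[OF b(1)] by blast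
  then show ?thesis using b(2)[of y] that[of "enn2real y"] by (simp add: ennreal_enn2real)
qed

text \<open>The sublevel set of \<sigma> is downward closed because \<sigma> is monotone, and it
  contains its supremum because \<sigma> is left-continuous; so it is exactly the half-line up to
  the quantile. Negative \<open>r\<close> fit in because \<open>ennreal r\<close> is then 0 and
  \<sigma> vanishes there.\<close>

lemma le_sigma_quantile_iff:
  assumes \<sigma>: "distance_distribution \<sigma>" and s: "s > 0"
  shows "r \<le> sigma_quantile \<sigma> s \<longleftrightarrow> \<sigma> (ennreal r) \<le> exp (- (1 / s))"
proof -
  define c where "c = exp (- (1 / s))"
  define A where "A = {r. \<sigma> (ennreal r) \<le> c}"
  have c: "0 < c" "c < 1" using s by (auto simp: c_def)
  have R: "sigma_quantile \<sigma> s = Sup A" using s by (simp add: sigma_quantile_def A_def c_def)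
  have "0 \<in> A" using c by (simp add: A_def distance_distribution_0[OF \<sigma>])
  obtain b where b: "\<sigma> (ennreal b) > c" using distance_distribution_exceeds[OF \<sigma> c(2)] .
  have bd: "bdd_above A"
  proof (rule bdd_aboveI)
    show "r \<le> b" if "r \<in> A" for r
      using that b distance_distribution_mono[OF \<sigma> ennreal_leI, of b r] by (force simp: A_def)
  qed
  have Sup: "\<sigma> (ennreal (Sup A)) \<le> c"
  proof (rule tendsto_upperbound)
    show "((\<lambda>r. \<sigma> (ennreal r)) \<longlongrightarrow> \<sigma> (ennreal (Sup A))) (at_left (Sup A))"
      using distance_distribution_powr_continuous[OF \<sigma>, of 1 "Sup A"]
      by (simp add: continuous_within distance_distribution_nonneg[OF \<sigma>])
    show "\<forall>\<^sub>F r in at_left (Sup A). \<sigma> (ennreal r) \<le> c"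
      unfolding eventually_at_filter
    proof (intro always_eventually allI impI)
      fix r assume "r \<noteq> Sup A" "r \<in> {..<Sup A}"
      then obtain a where "a \<in> A" "r < a"
        using less_cSup_iff[of A r] bd \<open>0 \<in> A\<close> by auto
      then show "\<sigma> (ennreal r) \<le> c"
        using distance_distribution_mono[OF \<sigma> ennreal_leI, of r a] by (simp add: A_def)
    qed
  qed simp
  have "r \<le> Sup A \<longleftrightarrow> \<sigma> (ennreal r) \<le> c"
  proof
    assume "r \<le> Sup A"
    then show "\<sigma> (ennreal r) \<le> c"
      using Sup distance_distribution_mono[OF \<sigma> ennreal_leI, of r "Sup A"] by simp
  next
    assume "\<sigma> (ennreal r) \<le> c"
    then show "r \<le> Sup A" using bd by (intro cSup_upper) (auto simp: A_def)
  qed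
  then show ?thesis by (simp add: R c_def)
qed

lemma sigma_quantile_nonneg:
  assumes "distance_distribution \<sigma>"
  shows "sigma_quantile \<sigma> s \<ge> 0"
proof (cases "s > 0")
  case True
  then show ?thesis
    using le_sigma_quantile_iff[OF assms True, of 0] by (simp add: distance_distribution_0[OF assms])
qed (simp add: sigma_quantile_def)

lemma sigma_quantile_mono:
  assumes "distance_distribution \<sigma>"
  shows "mono (sigma_quantile \<sigma>)"
proof (rule monoI)
  fix s t :: real assume st: "s \<le> t"
  show "sigma_quantile \<sigma> s \<le> sigma_quantile \<sigma> t"
  proof (cases "s > 0")
    case True
    then have "exp (- (1 / s)) \<le> exp (- (1 / t))" using st by (simp add: frac_le)
    then show ?thesis
      using True st le_sigma_quantile_iff[OF assms True, of "sigma_quantile \<sigma> s"]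
      by (subst le_sigma_quantile_iff[OF assms]) (auto intro: order_trans)
  next
    case False
    then have "sigma_quantile \<sigma> s = 0" by (simp add: sigma_quantile_def)
    then show ?thesis using sigma_quantile_nonneg[OF assms, of t] by simp
  qed
qed

section \<open>Intrinsic scales and intrinsic balls\<close>

text \<open>The intrinsic distance as a function of the distance. At \<open>r \<le> 0\<close> the
  conventions 1/0 = 0 and ln 0 = 0 give 0, which agrees with
  \<open>intrinsic_dist \<sigma> x x = 0\<close>.\<close>

definition intrinsic_scale :: "(ennreal \<Rightarrow> real) \<Rightarrow> real \<Rightarrow> real" where
  "intrinsic_scale \<sigma> r = 1 / ln (1 / \<sigma> (ennreal r))"

lemma intrinsic_scale_pos:
  assumes "distance_distribution \<sigma>" "r > 0"
  shows "intrinsic_scale \<sigma> r > 0"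
  using distance_distribution_pos[OF assms] distance_distribution_less_1[OF assms(1), of r]
  by (simp add: intrinsic_scale_def)

lemma intrinsic_scale_nonpos:
  assumes "distance_distribution \<sigma>" "r \<le> 0"
  shows "intrinsic_scale \<sigma> r = 0"
  using assms by (simp add: intrinsic_scale_def ennreal_neg distance_distribution_0)

lemma exp_intrinsic_scale:
  assumes "distance_distribution \<sigma>" "r > 0"
  shows "exp (- (t / intrinsic_scale \<sigma> r)) = \<sigma> (ennreal r) powr t"
  using distance_distribution_pos[OF assms]
  by (simp add: intrinsic_scale_def powr_def ln_div)

text \<open>For \<open>r > 0\<close> this takes logarithms in the preceding equivalence, since
  \<sigma> at \<open>r\<close> is exp(-1/scale); for \<open>r \<le> 0\<close> both sides are true.
  It is the adjunction by which conditions on radii become conditions on scales throughout.\<close>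

lemma le_sigma_quantile_iff_scale:
  assumes \<sigma>: "distance_distribution \<sigma>" and s: "s > 0"
  shows "r \<le> sigma_quantile \<sigma> s \<longleftrightarrow> intrinsic_scale \<sigma> r \<le> s"
proof (cases "r > 0")
  case True
  note pos = intrinsic_scale_pos[OF \<sigma> True]
  have "\<sigma> (ennreal r) = exp (- (1 / intrinsic_scale \<sigma> r))"
    using exp_intrinsic_scale[OF \<sigma> True, of 1] distance_distribution_pos[OF \<sigma> True] by simp
  then show ?thesis
    using pos s by (simp add: le_sigma_quantile_iff[OF \<sigma> s] field_simps)
next
  case False
  then show ?thesis
    using s sigma_quantile_nonneg[OF \<sigma>, of s] intrinsic_scale_nonpos[OF \<sigma>, of r] by simp
qed

lemma intrinsic_cball_eq_cball:
  fixes x :: "'a::metric_space"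
  assumes \<sigma>: "distance_distribution \<sigma>" and s: "s > 0"
  shows "intrinsic_cball \<sigma> x s = cball x (sigma_quantile \<sigma> s)"
proof -
  have "intrinsic_dist \<sigma> x y = intrinsic_scale \<sigma> (dist x y)" for y
    using intrinsic_scale_nonpos[OF \<sigma>, of 0] by (simp add: intrinsic_dist_def intrinsic_scale_def)
  then show ?thesis
    by (simp add: intrinsic_cball_def cball_def le_sigma_quantile_iff_scale[OF \<sigma> s])
qed

section \<open>The law of the scale at time t, and integration over time\<close>

text \<open>In \<open>s\<close> this is the Frechet density of shape 1 and scale \<open>t\<close>;
  in \<open>t\<close> it is the Gamma density of shape 2 and scale \<open>s\<close>. Both readings
  are used below.\<close>

definition scale_density :: "real \<Rightarrow> real \<Rightarrow> real" where
  "scale_density t s = t / s\<^sup>2 * exp (- (t / s))"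

lemma scale_density_nonneg: "t \<ge> 0 \<Longrightarrow> scale_density t s \<ge> 0"
  by (simp add: scale_density_def)

lemma measurable_scale_density [measurable]:
  "(\<lambda>(t, s). scale_density t s) \<in> borel_measurable (borel \<Otimes>\<^sub>M borel)"
  unfolding scale_density_def by measurable

lemma nn_integral_scale_density_less:
  assumes t: "t > 0" and w: "w > 0"
  shows "(\<integral>\<^sup>+ s. ennreal (scale_density t s) * indicator {0<..<w} s \<partial>lborel) = ennreal (exp (- (t / w)))"
proof -
  \<comment> \<open>Extending exp(-t/s) by 0 to the left gives an antiderivative that is
    differentiable at 0 as well, so the fundamental theorem applies on the closed interval
    \<open>{0..w}\<close>.\<close>
  define F where "F s = (if s \<le> 0 then 0 else exp (- (t / s)))" for s :: real
  have deriv: "(F has_real_derivative scale_density t s) (at s)" if "0 \<le> s" for s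
  proof (cases "s = 0")
    case True
    \<comment> \<open>The difference quotient at 0 vanishes on the left, and exp(-t/h)/h tends to 0
      on the right. The derivative 0 matches \<open>scale_density t 0\<close>, which is 0 because
      division by 0 gives 0.\<close>
    have l: "((\<lambda>h. F h / h) \<longlongrightarrow> 0) (at_left 0)"
      by (rule Lim_transform_eventually[OF tendsto_const])
         (auto simp: eventually_at_filter F_def intro!: always_eventually)
    have r: "((\<lambda>h. exp (- (t / h)) / h) \<longlongrightarrow> 0) (at_right 0)"
      using t by real_asymp
    have "((\<lambda>h. F h / h) \<longlongrightarrow> 0) (at_right 0)"
      by (rule Lim_transform_eventually[OF r])
         (auto simp: eventually_at_filter F_def intro!: always_eventually)
    with l have "((\<lambda>h. F h / h) \<longlongrightarrow> 0) (at 0)"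
      by (simp add: filterlim_split_at)
    then show ?thesis
      using True by (simp add: DERIV_def F_def scale_density_def)
  next
    case False
    then have s: "s > 0" using that by simp
    have d: "((\<lambda>s. exp (- (t / s))) has_real_derivative scale_density t s) (at s)"
      using s by (auto intro!: derivative_eq_intros simp: scale_density_def power2_eq_square)
    show ?thesis
      by (rule has_field_derivative_transform_within_open[OF d, of "{0<..}"])
         (use s in \<open>auto simp: F_def\<close>)
  qed
  have "(\<integral>\<^sup>+ s. ennreal (scale_density t s) * indicator {0<..<w} s \<partial>lborel) =
      (\<integral>\<^sup>+ s. ennreal (scale_density t s) * indicator {0..w} s \<partial>lborel)"
    by (intro nn_integral_cong_AE)
       (use AE_lborel_singleton[of 0] AE_lborel_singleton[of w] in \<open>eventually_elim, auto simp: indicator_def\<close>)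
  also have "\<dots> = ennreal (F w - F 0)"
    using t w deriv by (intro nn_integral_FTC_Icc) (auto simp: scale_density_nonneg)
  finally show ?thesis using w by (simp add: F_def)
qed

text \<open>Integration by parts yields the antiderivative -(t/s + 1) exp(-t/s). The total mass 1 is
  what removes time from the Green function.\<close>

lemma nn_integral_scale_density_time:
  assumes s: "s > 0"
  shows "(\<integral>\<^sup>+ t. ennreal (scale_density t s) * indicator {0..} t \<partial>lborel) = 1"
proof -
  have "(\<integral>\<^sup>+ t. ennreal (scale_density t s) * indicator {0..} t \<partial>lborel) =
      ennreal (0 - (- (0 / s + 1) * exp (- (0 / s))))"
  proof (rule nn_integral_FTC_atLeast)
    show "((\<lambda>t. - (t / s + 1) * exp (- (t / s))) \<longlongrightarrow> 0) at_top"
      using s by real_asymp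
    show "DERIV (\<lambda>t. - (t / s + 1) * exp (- (t / s))) t :> scale_density t s" for t
      using s by (auto intro!: derivative_eq_intros simp: scale_density_def field_simps power2_eq_square)
  qed (auto simp: scale_density_nonneg)
  then show ?thesis by simp
qed

text \<open>It suffices to compare half-lines \<open>{..<w}\<close>. The quantile at
  \<open>s > 0\<close> lies below \<open>w\<close> iff \<open>s\<close> lies below the scale of
  \<open>w\<close>, so the image measure gives the mass exp(-t/scale), which is the
  \<open>t\<close>-th power of \<sigma> at \<open>w\<close>. For \<open>w \<le> 0\<close> both
  masses are 0.\<close>

lemma dsigma_eq_distr:
  assumes \<sigma>: "distance_distribution \<sigma>" and t: "t > 0"
  shows "dsigma \<sigma> t =
    distr (density lborel (\<lambda>s. ennreal (scale_density t s) * indicator {0<..} s)) borel (sigma_quantile \<sigma>)"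
    (is "_ = ?D")
proof (rule measure_eqI_lessThan_real)
  have [measurable]: "sigma_quantile \<sigma> \<in> borel_measurable borel"
    by (rule borel_measurable_mono[OF sigma_quantile_mono[OF \<sigma>]])
  show eq: "emeasure (dsigma \<sigma> t) {..<w} = emeasure ?D {..<w}" for w
  proof -
    have ind: "indicator {0<..} s * indicator (sigma_quantile \<sigma> -` {..<w}) s =
        (indicator {0<..<intrinsic_scale \<sigma> w} s :: ennreal)" for s
      using le_sigma_quantile_iff_scale[OF \<sigma>, of s w] by (auto simp: indicator_def)
    have "emeasure ?D {..<w} =
        (\<integral>\<^sup>+ s. ennreal (scale_density t s) * indicator {0<..} s * indicator (sigma_quantile \<sigma> -` {..<w}) s \<partial>lborel)"
      using measurable_sets[of "sigma_quantile \<sigma>" borel borel "{..<w}"]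
      by (subst emeasure_distr; simp add: emeasure_density)
    also have "\<dots> = (\<integral>\<^sup>+ s. ennreal (scale_density t s) * indicator {0<..<intrinsic_scale \<sigma> w} s \<partial>lborel)"
      by (simp add: mult.assoc ind)
    also have "\<dots> = ennreal (\<sigma> (ennreal w) powr t)"
    proof (cases "w > 0")
      case True
      then show ?thesis
        using nn_integral_scale_density_less[OF t intrinsic_scale_pos[OF \<sigma> True]]
        by (simp add: exp_intrinsic_scale[OF \<sigma>])
    next
      case False
      then show ?thesis
        using intrinsic_scale_nonpos[OF \<sigma>, of w] by (simp add: ennreal_neg distance_distribution_0[OF \<sigma>])
    qed
    finally show ?thesis by (simp add: emeasure_dsigma_lessThan[OF \<sigma> t])
  qed
  show "emeasure (dsigma \<sigma> t) {..<w} < \<infinity>" for w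
    by (simp add: emeasure_dsigma_lessThan[OF \<sigma> t])
qed simp_all

text \<open>After writing \<open>dsigma \<sigma> t\<close> as an image measure, Tonelli puts the
  time integral inside, where it equals 1 for each \<open>s > 0\<close>.\<close>

lemma nn_integral_time_dsigma:
  assumes \<sigma>: "distance_distribution \<sigma>" and h [measurable]: "h \<in> borel_measurable borel"
  shows "(\<integral>\<^sup>+ t\<in>{0<..}. (\<integral>\<^sup>+ r. h r \<partial>dsigma \<sigma> t) \<partial>lborel) =
    (\<integral>\<^sup>+ s\<in>{0<..}. h (sigma_quantile \<sigma> s) \<partial>lborel)"
proof -
  let ?R = "sigma_quantile \<sigma>"
  have [measurable]: "?R \<in> borel_measurable borel"
    by (rule borel_measurable_mono[OF sigma_quantile_mono[OF \<sigma>]])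
  have "(\<integral>\<^sup>+ t\<in>{0<..}. (\<integral>\<^sup>+ r. h r \<partial>dsigma \<sigma> t) \<partial>lborel) =
      (\<integral>\<^sup>+ t. (\<integral>\<^sup>+ s. h (?R s) * indicator {0<..} s * (ennreal (scale_density t s) * indicator {0<..} t) \<partial>lborel) \<partial>lborel)"
  proof (intro nn_integral_cong)
    fix t :: real
    show "(\<integral>\<^sup>+ r. h r \<partial>dsigma \<sigma> t) * indicator {0<..} t =
        (\<integral>\<^sup>+ s. h (?R s) * indicator {0<..} s * (ennreal (scale_density t s) * indicator {0<..} t) \<partial>lborel)"
    proof (cases "t > 0")
      case True
      then have "(\<integral>\<^sup>+ r. h r \<partial>dsigma \<sigma> t) =
          (\<integral>\<^sup>+ s. ennreal (scale_density t s) * indicator {0<..} s * h (?R s) \<partial>lborel)"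
        by (simp add: dsigma_eq_distr[OF \<sigma>] nn_integral_distr nn_integral_density)
      then show ?thesis using True by (simp add: mult_ac)
    qed simp
  qed
  also have "\<dots> =
      (\<integral>\<^sup>+ s. (\<integral>\<^sup>+ t. h (?R s) * indicator {0<..} s * (ennreal (scale_density t s) * indicator {0<..} t) \<partial>lborel) \<partial>lborel)"
    by (rule lborel_pair.Fubini') measurable
  also have "\<dots> = (\<integral>\<^sup>+ s\<in>{0<..}. h (?R s) \<partial>lborel)"
  proof (intro nn_integral_cong)
    fix s :: real
    have "(\<integral>\<^sup>+ t. ennreal (scale_density t s) * indicator {0<..} t \<partial>lborel) =
        (\<integral>\<^sup>+ t. ennreal (scale_density t s) * indicator {0..} t \<partial>lborel)"
      by (intro nn_integral_cong) (auto simp: indicator_def scale_density_def)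
    then show "(\<integral>\<^sup>+ t. h (?R s) * indicator {0<..} s * (ennreal (scale_density t s) * indicator {0<..} t) \<partial>lborel) =
        h (?R s) * indicator {0<..} s"
      by (cases "s > 0") (simp_all add: nn_integral_cmult nn_integral_scale_density_time)
  qed
  finally show ?thesis .
qed

lemma nn_integral_lborel_atLeast_eq_greaterThan:
  "(\<integral>\<^sup>+ t\<in>{a..}. f t \<partial>lborel) = (\<integral>\<^sup>+ t\<in>{a<..}. f t \<partial>lborel)" for a :: real
  by (intro nn_integral_cong_AE)
     (use AE_lborel_singleton[of a] in \<open>eventually_elim, auto simp: indicator_def\<close>)

lemma inverse_ennreal_antimono: "a \<le> b \<Longrightarrow> inverse b \<le> inverse (a :: ennreal)"
  including ennreal.lifting by transfer (rule ereal_inverse_antimono)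

lemma emeasure_lborel_atLeast: "emeasure lborel {a::real..} = \<infinity>"
proof (rule ccontr)
  assume "emeasure lborel {a..} \<noteq> \<infinity>"
  then obtain n :: nat where n: "emeasure lborel {a..} < of_nat n"
    using ennreal_Ex_less_of_nat by (auto simp: less_top)
  have "emeasure lborel {a..a + real n} \<le> emeasure lborel {a..}"
    by (intro emeasure_mono) auto
  with n show False by (simp add: ennreal_of_nat_eq_real_of_nat)
qed

section \<open>Volumes of intrinsic balls\<close>

locale isotropic =
  fixes \<mu> :: "'a::metric_space measure" and \<sigma> :: "ennreal \<Rightarrow> real"
  assumes separable: "separable_space (euclidean :: 'a topology)"
    and ultrametric: "ultrametric_space TYPE('a)"
    and compact_cball: "\<forall>(x::'a) r. compact (cball x r)"
    and radon: "radon_measure \<mu>" and full_support: "full_support \<mu>"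
    and sigma: "distance_distribution \<sigma>"
begin

abbreviation radius :: "real \<Rightarrow> real" where
  "radius \<equiv> sigma_quantile \<sigma>"

text \<open>The integrand of (iii). For \<open>s < 0\<close> the ball is empty and the value is
  infinite, so the estimates below stay in \<open>s > 0\<close>.\<close>

definition inverse_volume :: "'a \<Rightarrow> real \<Rightarrow> ennreal" where
  "inverse_volume x s = 1 / emeasure \<mu> (intrinsic_cball \<sigma> x s)"

lemma sets_mu: "sets \<mu> = sets borel"
  using radon by (simp add: radon_measure_def)

lemma sigma_finite: "sigma_finite_measure \<mu>"
  by (rule radon_sigma_finite[OF compact_cball radon])

lemma measurable_radius [measurable]: "radius \<in> borel_measurable borel"
  by (rule borel_measurable_mono[OF sigma_quantile_mono[OF sigma]])

lemma emeasure_cball_finite: "emeasure \<mu> (cball x r) < \<infinity>"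
  using compact_cball radon unfolding radon_measure_def by metis

lemma emeasure_cball_pos:
  assumes "r > 0"
  shows "emeasure \<mu> (cball x r) > 0"
proof -
  have "0 < emeasure \<mu> (ball x r)"
    using assms full_support by (auto simp: full_support_def)
  also have "\<dots> \<le> emeasure \<mu> (cball x r)"
    by (intro emeasure_mono) (auto simp: sets_mu)
  finally show ?thesis .
qed

text \<open>As \<sigma> tends to 0 at 0+, some positive radius already satisfies the condition
  defining the quantile. Full support then gives all intrinsic balls of positive radius positive
  measure.\<close>

lemma radius_pos:
  assumes "s > 0"
  shows "radius s > 0"
proof -
  have "(\<sigma> \<longlongrightarrow> 0) (at_right 0)" "exp (- (1 / s)) > 0"
    using sigma by (auto simp: distance_distribution_def)
  then have "\<forall>\<^sub>F r in at_right 0. \<sigma> r < exp (- (1 / s))"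
    by (rule order_tendstoD)
  then obtain b where b: "b > 0" "\<And>y. 0 < y \<Longrightarrow> y < b \<Longrightarrow> \<sigma> y < exp (- (1 / s))"
    using eventually_at_right[of "0::ennreal" 1] by auto
  obtain y where y: "0 < y" "y < b" using dense[OF b(1)] by blast
  then have "y < top" using less_top_ennreal order_less_le_trans by (metis top.not_eq_extremum top_greatest)
  then have "enn2real y > 0" "\<sigma> (ennreal (enn2real y)) \<le> exp (- (1 / s))"
    using y b(2)[of y] by (auto simp: enn2real_positive_iff)
  then show ?thesis
    using le_sigma_quantile_iff[OF sigma assms, of "enn2real y"] by simp
qed

lemma inverse_volume_eq: "s > 0 \<Longrightarrow> inverse_volume x s = 1 / emeasure \<mu> (cball x (radius s))"
  by (simp add: inverse_volume_def intrinsic_cball_eq_cball[OF sigma])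

lemma inverse_volume_finite:
  assumes "s > 0"
  shows "inverse_volume x s < \<infinity>"
  using emeasure_cball_pos[OF radius_pos[OF assms], of x]
  by (simp add: inverse_volume_eq[OF assms] ennreal_divide_eq_top_iff less_top[symmetric])

lemma inverse_volume_antimono:
  assumes "0 < s" "s \<le> t"
  shows "inverse_volume x t \<le> inverse_volume x s"
proof -
  have "radius s \<le> radius t"
    using monoD[OF sigma_quantile_mono[OF sigma]] assms by simp
  then have "emeasure \<mu> (cball x (radius s)) \<le> emeasure \<mu> (cball x (radius t))"
    by (intro emeasure_mono) (auto simp: sets_mu)
  then show ?thesis
    using assms by (simp add: inverse_volume_eq divide_ennreal_def inverse_ennreal_antimono)
qed

lemma measurable_averaging_op_radius:
  assumes "f \<in> borel_measurable borel"
  shows "(\<lambda>r. averaging_op \<mu> r f x) \<in> borel_measurable borel"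
  using measurable_compose[OF _ measurable_averaging_op[OF separable sigma_finite sets_mu assms],
      of "\<lambda>r. (r, x)" borel]
  by simp

lemma measurable_inverse_emeasure_cball [measurable]:
  "(\<lambda>r. 1 / emeasure \<mu> (cball x r)) \<in> borel_measurable borel"
proof -
  interpret sigma_finite_measure \<mu> by (rule sigma_finite)
  note [measurable_cong] = sets_mu
  note [measurable] = measurable_dist_separable[OF separable]
  have eq: "emeasure \<mu> (cball x r) = (\<integral>\<^sup>+ y. of_bool (dist x y \<le> r) \<partial>\<mu>)" for r
  proof -
    have "emeasure \<mu> (cball x r) = (\<integral>\<^sup>+ y. indicator (cball x r) y \<partial>\<mu>)"
      by (subst nn_integral_indicator) (auto simp: sets_mu)
    then show ?thesis by (simp add: indicator_def of_bool_def)
  qed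
  show ?thesis unfolding eq by measurable
qed

lemma measurable_inverse_volume:
  assumes "b > 0"
  shows "(\<lambda>s. inverse_volume x s * indicator {b..} s) \<in> borel_measurable borel"
proof -
  have "(\<lambda>s. 1 / emeasure \<mu> (cball x (radius s)) * indicator {b..} s) \<in> borel_measurable borel"
    by measurable
  moreover have "1 / emeasure \<mu> (cball x (radius s)) * indicator {b..} s =
      inverse_volume x s * indicator {b..} s" for s
    using assms by (auto simp: indicator_def inverse_volume_eq)
  ultimately show ?thesis by simp
qed

section \<open>The Green function and operator as integrals over scales\<close>

text \<open>Integrating out time leaves the condition \<open>dist x y \<le> radius s\<close>, which
  says that \<open>s\<close> is at least the scale of \<open>dist x y\<close>. That scale is
  positive for distinct points, so the range avoids \<open>s \<le> 0\<close>.\<close>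

lemma green_function_eq:
  assumes "x \<noteq> y"
  shows "green_function \<mu> \<sigma> x y =
    (\<integral>\<^sup>+ s\<in>{intrinsic_scale \<sigma> (dist x y)..}. inverse_volume x s \<partial>lborel)"
proof -
  let ?d = "intrinsic_scale \<sigma> (dist x y)"
  have pos: "?d > 0" using intrinsic_scale_pos[OF sigma] assms by simp
  have "green_function \<mu> \<sigma> x y =
      (\<integral>\<^sup>+ t\<in>{0<..}. (\<integral>\<^sup>+ r. 1 / emeasure \<mu> (cball x r) * indicator {dist x y..} r \<partial>dsigma \<sigma> t) \<partial>lborel)"
    by (simp add: green_function_def heat_kernel_def nn_integral_lborel_atLeast_eq_greaterThan)
  also have "\<dots> = (\<integral>\<^sup>+ s\<in>{0<..}. (1 / emeasure \<mu> (cball x (radius s)) *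
      indicator {dist x y..} (radius s)) \<partial>lborel)"
    by (intro nn_integral_time_dsigma[OF sigma]) measurable
  also have "\<dots> = (\<integral>\<^sup>+ s\<in>{?d..}. inverse_volume x s \<partial>lborel)"
  proof (intro nn_integral_cong)
    fix s :: real
    show "1 / emeasure \<mu> (cball x (radius s)) * indicator {dist x y..} (radius s) * indicator {0<..} s =
        inverse_volume x s * indicator {?d..} s"
      using pos le_sigma_quantile_iff_scale[OF sigma, of s "dist x y"]
      by (cases "s > 0") (auto simp: inverse_volume_eq indicator_def)
  qed
  finally show ?thesis .
qed

lemma green_operator_eq:
  assumes f: "f \<in> borel_measurable borel"
  shows "green_operator \<mu> \<sigma> f x = (\<integral>\<^sup>+ s\<in>{0<..}. averaging_op \<mu> (radius s) f x \<partial>lborel)"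
proof -
  note [measurable] = measurable_averaging_op_radius[OF f]
  have "green_operator \<mu> \<sigma> f x =
      (\<integral>\<^sup>+ t\<in>{0<..}. (\<integral>\<^sup>+ r. averaging_op \<mu> r f x * indicator {0..} r \<partial>dsigma \<sigma> t) \<partial>lborel)"
    \<comment> \<open>Time 0, where the semigroup is the identity and not an integral against
      \<open>dsigma\<close>, is a null set and is dropped.\<close>
    unfolding green_operator_def nn_integral_lborel_atLeast_eq_greaterThan
    by (intro nn_integral_cong) (auto simp: isotropic_semigroup_def indicator_def)
  also have "\<dots> = (\<integral>\<^sup>+ s\<in>{0<..}. (averaging_op \<mu> (radius s) f x * indicator {0..} (radius s)) \<partial>lborel)"
    by (intro nn_integral_time_dsigma[OF sigma]) measurable
  finally show ?thesis by (simp add: sigma_quantile_nonneg[OF sigma])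
qed

section \<open>Convergence at infinity and its independence of the point\<close>

text \<open>The integrand is antitone on \<open>s > 0\<close>, so on a bounded interval starting at
  \<open>b\<close> it is at most its finite value at \<open>b\<close>. Only the tail
  decides.\<close>

lemma converges_at_infinity_iff:
  assumes b: "b > 0"
  shows "converges_at_infinity (inverse_volume x) \<longleftrightarrow>
    (\<integral>\<^sup>+ s\<in>{b..}. inverse_volume x s \<partial>lborel) < \<infinity>"
proof
  assume "converges_at_infinity (inverse_volume x)"
  then obtain a where a: "(\<integral>\<^sup>+ s\<in>{a..}. inverse_volume x s \<partial>lborel) < \<infinity>"
    by (auto simp: converges_at_infinity_def)
  define c where "c = max a b"
  have "(\<integral>\<^sup>+ s\<in>{c..}. inverse_volume x s \<partial>lborel) \<le> (\<integral>\<^sup>+ s\<in>{a..}. inverse_volume x s \<partial>lborel)"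
    by (intro nn_integral_mono) (auto simp: indicator_def c_def)
  then have c: "(\<integral>\<^sup>+ s\<in>{c..}. inverse_volume x s \<partial>lborel) < \<infinity>" using a by simp
  have [measurable]: "(\<lambda>s. inverse_volume x s * indicator {c..} s) \<in> borel_measurable borel"
    using b by (intro measurable_inverse_volume) (simp add: c_def)
  have "(\<integral>\<^sup>+ s\<in>{b..}. inverse_volume x s \<partial>lborel) \<le>
      (\<integral>\<^sup>+ s. inverse_volume x b * indicator {b..c} s + inverse_volume x s * indicator {c..} s \<partial>lborel)"
    by (intro nn_integral_mono)
       (auto simp: indicator_def c_def inverse_volume_antimono[OF b] split: split_max)
  also have "\<dots> = (\<integral>\<^sup>+ s. inverse_volume x b * indicator {b..c} s \<partial>lborel) +
      (\<integral>\<^sup>+ s\<in>{c..}. inverse_volume x s \<partial>lborel)"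
    by (rule nn_integral_add) auto
  also have "\<dots> < \<infinity>"
    using c inverse_volume_finite[OF b, of x]
    by (simp add: nn_integral_cmult_indicator ennreal_mult_less_top c_def)
  finally show "(\<integral>\<^sup>+ s\<in>{b..}. inverse_volume x s \<partial>lborel) < \<infinity>" .
qed (auto simp: converges_at_infinity_def)

lemma cball_radius_eq:
  fixes x y :: 'a
  assumes "intrinsic_scale \<sigma> (dist x y) \<le> s" "s > 0"
  shows "cball x (radius s) = cball y (radius s)"
  by (rule ultrametric_cball_eq[OF ultrametric])
     (use assms in \<open>simp add: le_sigma_quantile_iff_scale[OF sigma]\<close>)

lemma converges_at_infinity_indep:
  assumes "converges_at_infinity (inverse_volume x)"
  shows "converges_at_infinity (inverse_volume y)"
proof -
  \<comment> \<open>From the scale of \<open>dist x y\<close> on, the intrinsic balls around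
    \<open>x\<close> and \<open>y\<close> coincide; the maximum with 1 keeps \<open>b\<close>
    positive when \<open>x = y\<close>.\<close>
  define b where "b = max 1 (intrinsic_scale \<sigma> (dist x y))"
  have b: "b > 0" by (simp add: b_def)
  have "(\<integral>\<^sup>+ s\<in>{b..}. inverse_volume y s \<partial>lborel) = (\<integral>\<^sup>+ s\<in>{b..}. inverse_volume x s \<partial>lborel)"
    using b cball_radius_eq[of x y]
    by (intro nn_integral_cong) (auto simp: indicator_def inverse_volume_eq b_def)
  then show ?thesis using assms by (simp add: converges_at_infinity_iff[OF b])
qed

lemma converges_iff_green_function_finite:
  assumes "x \<noteq> y"
  shows "green_function \<mu> \<sigma> x y < \<infinity> \<longleftrightarrow> converges_at_infinity (inverse_volume x)"
  using converges_at_infinity_iff[OF intrinsic_scale_pos[OF sigma], of "dist x y" x] assms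
  by (simp add: green_function_eq)

text \<open>In a one-point space all balls of positive radius have the same finite measure, so the
  integrand is a positive constant and the integral diverges. This supplies the pair that the "some"
  version of (ii) asks for.\<close>

lemma converges_imp_distinct_points:
  assumes "converges_at_infinity (inverse_volume x)"
  shows "\<exists>y. x \<noteq> y"
proof (rule ccontr)
  assume "\<nexists>y. x \<noteq> y"
  then have ball: "cball x r = cball x 1" if "r > 0" for r
    using that by (auto simp: set_eq_iff) (metis dist_self less_imp_le zero_le_one)+
  have "(\<integral>\<^sup>+ s\<in>{1..}. inverse_volume x s \<partial>lborel) =
      (\<integral>\<^sup>+ s. 1 / emeasure \<mu> (cball x 1) * indicator {1::real..} s \<partial>lborel)"
    using ball[OF radius_pos]
    by (intro nn_integral_cong) (auto simp: indicator_def inverse_volume_eq)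
  also have "\<dots> = \<infinity>"
    using emeasure_cball_finite[of x 1]
    by (simp add: nn_integral_cmult_indicator emeasure_lborel_atLeast)
  finally show False using assms by (simp add: converges_at_infinity_iff[of 1])
qed

section \<open>Transience against convergence of the integral\<close>

text \<open>The test function is the indicator of the unit ball around \<open>x\<close>. From the
  scale \<open>b\<close> of radius 1 on, the intrinsic ball contains the unit ball, so the average
  at \<open>x\<close> is \<open>?m\<close> times the inverse volume. As \<open>?m\<close> is
  positive, finiteness of the Green operator at \<open>x\<close> bounds the tail.\<close>

lemma transient_imp_converges:
  assumes "transient_semigroup \<mu> \<sigma>"
  shows "converges_at_infinity (inverse_volume x)"
proof -
  define f :: "'a \<Rightarrow> ennreal" where "f = indicator (cball x 1)"
  define b where "b = intrinsic_scale \<sigma> 1"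
  have b: "b > 0" using intrinsic_scale_pos[OF sigma] by (simp add: b_def)
  have f: "f \<in> borel_measurable borel" unfolding f_def by (rule borel_measurable_indicator) simp
  have supp: "{x. f x \<noteq> 0} = cball x 1" by (auto simp: f_def indicator_def)
  have "bounded_ennreal f"
    unfolding bounded_ennreal_def by (rule exI[of _ 1]) (simp add: f_def indicator_def)
  then have "bounded_ennreal (green_operator \<mu> \<sigma> f)"
    using assms f compact_cball by (simp add: transient_semigroup_def supp)
  then have fin: "green_operator \<mu> \<sigma> f x < \<infinity>"
    unfolding bounded_ennreal_def by (metis ennreal_less_top infinity_ennreal_def order_le_less_trans)
  let ?m = "emeasure \<mu> (cball x 1)"
  have "?m * (\<integral>\<^sup>+ s\<in>{b..}. inverse_volume x s \<partial>lborel) =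
      (\<integral>\<^sup>+ s. ?m * (inverse_volume x s * indicator {b..} s) \<partial>lborel)"
    using measurable_inverse_volume[OF b] by (intro nn_integral_cmult[symmetric]) simp
  also have "\<dots> \<le> green_operator \<mu> \<sigma> f x"
    unfolding green_operator_eq[OF f]
  proof (intro nn_integral_mono)
    fix s
    show "?m * (inverse_volume x s * indicator {b..} s) \<le>
        averaging_op \<mu> (radius s) f x * indicator {0<..} s"
    proof (cases "b \<le> s")
      case True
      with b have s: "s > 0" by simp
      have "1 \<le> radius s" using le_sigma_quantile_iff_scale[OF sigma s] True by (simp add: b_def)
      then have "cball x 1 \<inter> cball x (radius s) = cball x 1" by auto
      then have "(\<integral>\<^sup>+ y\<in>cball x (radius s). f y \<partial>\<mu>) = ?m"
        by (simp add: f_def flip: indicator_inter_arith) (simp add: nn_integral_indicator sets_mu)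
      then show ?thesis
        using s True by (simp add: averaging_op_def inverse_volume_eq ennreal_times_divide)
    qed simp
  qed
  finally have "?m * (\<integral>\<^sup>+ s\<in>{b..}. inverse_volume x s \<partial>lborel) < \<infinity>"
    using fin by simp
  then show ?thesis
    using emeasure_cball_pos[of 1 x] by (auto simp: converges_at_infinity_iff[OF b] ennreal_mult_less_top)
qed

lemma averaging_op_le:
  assumes f: "\<And>y. f y \<le> C" and r: "r > 0"
  shows "averaging_op \<mu> r f x \<le> C"
proof -
  have "(\<integral>\<^sup>+ y\<in>cball x r. f y \<partial>\<mu>) \<le> (\<integral>\<^sup>+ y\<in>cball x r. C \<partial>\<mu>)"
    using f by (intro nn_integral_mono) (auto simp: indicator_def)
  also have "\<dots> = C * emeasure \<mu> (cball x r)"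
    by (subst nn_integral_cmult_indicator) (auto simp: sets_mu)
  finally show ?thesis
    unfolding averaging_op_def using emeasure_cball_pos[OF r, of x] emeasure_cball_finite[of x r]
    by (intro divide_le_posI_ennreal) (auto simp: mult.commute)
qed

text \<open>The support of \<open>f\<close> lies in a ball of radius \<open>e\<close> around the
  reference point, and \<open>b\<close> is the scale of \<open>e\<close>. Below \<open>b\<close>
  averages are at most \<open>C\<close>. From \<open>b\<close> on, the ball around \<open>x\<close>
  either equals the one around the reference point or misses the support, by the ultra-metric
  inequality. The bound therefore involves only the reference point and is uniform in
  \<open>x\<close>.\<close>

lemma converges_imp_transient:
  assumes "converges_at_infinity (inverse_volume x\<^sub>0)"
  shows "transient_semigroup \<mu> \<sigma>"
  unfolding transient_semigroup_def
proof (intro ballI impI, elim conjE)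
  fix f :: "'a \<Rightarrow> ennreal"
  assume f: "f \<in> borel_measurable borel" and bd: "bounded_ennreal f" and K: "compact (closure {x. f x \<noteq> 0})"
  obtain C' where C': "f x \<le> ennreal C'" for x using bd by (auto simp: bounded_ennreal_def)
  define C where "C = ennreal C'"
  have C: "f x \<le> C" "C < \<infinity>" for x using C' by (auto simp: C_def)
  have "bounded {x. f x \<noteq> 0}"
    using compact_imp_bounded[OF K] closure_subset bounded_subset by blast
  then obtain e where e: "e > 0" "{x. f x \<noteq> 0} \<subseteq> cball x\<^sub>0 e"
    using bounded_subset_ballD ball_subset_cball by (metis subset_trans)
  define b where "b = intrinsic_scale \<sigma> e"
  have b: "b > 0" using intrinsic_scale_pos[OF sigma e(1)] by (simp add: b_def)
  let ?m = "emeasure \<mu> (cball x\<^sub>0 e)"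
  have [measurable]: "(\<lambda>s. inverse_volume x\<^sub>0 s * indicator {b..} s) \<in> borel_measurable borel"
    by (rule measurable_inverse_volume[OF b])
  \<comment> \<open>The first term bounds the scales up to \<open>b\<close>, the second the scales
    from \<open>b\<close> on.\<close>
  define B where "B = C * ennreal b + C * ?m * (\<integral>\<^sup>+ s\<in>{b..}. inverse_volume x\<^sub>0 s \<partial>lborel)"
  have "B < \<infinity>"
    using C(2) emeasure_cball_finite[of x\<^sub>0 e] assms
    by (simp add: B_def converges_at_infinity_iff[OF b] ennreal_mult_less_top)
  moreover have "green_operator \<mu> \<sigma> f x \<le> B" for x
  proof -
    have "green_operator \<mu> \<sigma> f x \<le> (\<integral>\<^sup>+ s. C * indicator {0..b} s +
        C * ?m * (inverse_volume x\<^sub>0 s * indicator {b..} s) \<partial>lborel)"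
      unfolding green_operator_eq[OF f]
    proof (intro nn_integral_mono)
      fix s :: real
      consider "s \<le> 0" | "0 < s" "s < b" | "b \<le> s" by linarith
      then show "averaging_op \<mu> (radius s) f x * indicator {0<..} s \<le>
          C * indicator {0..b} s + C * ?m * (inverse_volume x\<^sub>0 s * indicator {b..} s)"
      proof cases
        case 2
        then show ?thesis using averaging_op_le[of f C "radius s" x] C(1) radius_pos[of s] by simp
      next
        case 3
        with b have s: "s > 0" by simp
        have le: "averaging_op \<mu> (radius s) f x \<le> C * ?m * inverse_volume x\<^sub>0 s"
        proof (cases "dist x x\<^sub>0 \<le> radius s")
          case True
          then have eq: "cball x (radius s) = cball x\<^sub>0 (radius s)"
            by (rule ultrametric_cball_eq[OF ultrametric])
          have "(\<integral>\<^sup>+ y\<in>cball x (radius s). f y \<partial>\<mu>) \<le> (\<integral>\<^sup>+ y. C * indicator (cball x\<^sub>0 e) y \<partial>\<mu>)"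
            using C(1) e(2) by (intro nn_integral_mono) (auto simp: indicator_def)
          also have "\<dots> = C * ?m"
            by (subst nn_integral_cmult_indicator) (auto simp: sets_mu)
          finally show ?thesis
            by (simp add: averaging_op_def inverse_volume_eq[OF s] eq ennreal_times_divide divide_right_mono_ennreal)
        next
          case False
          have "e \<le> radius s"
            using le_sigma_quantile_iff_scale[OF sigma s] 3 by (simp add: b_def)
          have "f y = 0" if "dist x y \<le> radius s" for y
          proof (rule ccontr)
            assume "f y \<noteq> 0"
            then have "dist y x\<^sub>0 \<le> e" using e(2) by (auto simp: dist_commute)
            then have "max (dist x y) (dist y x\<^sub>0) \<le> radius s"
              using that \<open>e \<le> radius s\<close> by simp
            moreover have "dist x x\<^sub>0 \<le> max (dist x y) (dist y x\<^sub>0)"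
              using ultrametric unfolding ultrametric_space_def by blast
            ultimately show False using False by linarith
          qed
          then have "(\<integral>\<^sup>+ y\<in>cball x (radius s). f y \<partial>\<mu>) = (\<integral>\<^sup>+ y. 0 \<partial>\<mu>)"
            by (intro nn_integral_cong) (auto simp: indicator_def)
          then show ?thesis by (simp add: averaging_op_def)
        qed
        then show ?thesis using 3 s by (auto simp: indicator_def intro: add_increasing)
      qed simp
    qed
    also have "\<dots> = B"
      using b by (subst nn_integral_add) (auto simp: nn_integral_cmult nn_integral_cmult_indicator B_def)
    finally show ?thesis .
  qed
  ultimately show "bounded_ennreal (green_operator \<mu> \<sigma> f)"
    unfolding bounded_ennreal_def
    by (intro exI[of _ "enn2real B"]) (simp add: ennreal_enn2real)
qed

end

section \<open>The equivalences\<close>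

theorem theorem2p28:
  fixes \<mu> :: "'a::metric_space measure" and \<sigma> :: "ennreal \<Rightarrow> real"
  assumes "separable_space (euclidean :: 'a topology)"
    and "ultrametric_space TYPE('a)"
    and "\<forall>(x::'a) r. compact (cball x r)"
    and "radon_measure \<mu>" and "full_support \<mu>"
    and "distance_distribution \<sigma>"
  shows
    "(transient_semigroup \<mu> \<sigma> \<longleftrightarrow>
        (\<exists>x y. x \<noteq> y \<and> green_function \<mu> \<sigma> x y < \<infinity>)) \<and>
     ((\<exists>x y :: 'a. x \<noteq> y) \<longrightarrow>
        (transient_semigroup \<mu> \<sigma> \<longleftrightarrow>
          (\<forall>x y. x \<noteq> y \<longrightarrow> green_function \<mu> \<sigma> x y < \<infinity>))) \<and>
     (transient_semigroup \<mu> \<sigma> \<longleftrightarrow>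
        (\<exists>x. converges_at_infinity (\<lambda>s. 1 / emeasure \<mu> (intrinsic_cball \<sigma> x s)))) \<and>
     (transient_semigroup \<mu> \<sigma> \<longleftrightarrow>
        (\<forall>x. converges_at_infinity (\<lambda>s. 1 / emeasure \<mu> (intrinsic_cball \<sigma> x s))))"
proof -
  interpret isotropic \<mu> \<sigma> by standard (fact assms)+
  have fold_volume: "(\<lambda>s. 1 / emeasure \<mu> (intrinsic_cball \<sigma> x s)) = inverse_volume x" for x
    by (simp add: inverse_volume_def fun_eq_iff)
  \<comment> \<open>Holding for each single \<open>x\<close>, this gives both "some" and "all" in
    (iii), since the type is inhabited.\<close>
  have converges: "transient_semigroup \<mu> \<sigma> \<longleftrightarrow> converges_at_infinity (inverse_volume x)" for x
    using transient_imp_converges converges_imp_transient by blast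
  have green: "transient_semigroup \<mu> \<sigma> \<longleftrightarrow> green_function \<mu> \<sigma> x y < \<infinity>" if "x \<noteq> y" for x y
    using converges converges_iff_green_function_finite[OF that] by blast
  \<comment> \<open>Needed for "some" in (ii): the equivalence \<open>green\<close> speaks only once
    a pair of distinct points is given.\<close>
  have "\<exists>x y :: 'a. x \<noteq> y" if "transient_semigroup \<mu> \<sigma>"
    using that converges converges_imp_distinct_points by blast
  then show ?thesis
    unfolding fold_volume using converges green by blast
qed

end
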